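(* Let $m,n\in\mathbb{N}$, let $\mathbf{D}$ be a finite field, let $\mathbf{M}_n(\mathbf{D})$ be the ring of $n\times n$ matrices over $\mathbf{D}$, and let $\mathbf{D}^{(n\times m)}$ denote the $\mathbf{M}_n(\mathbf{D})$-module of all $n\times m$ matrices with entries from $\mathbf{D}$. Let $k\in\mathbb{N}$ and $q=|D|$. Then $\mathbf{D}^{(n\times m)}$ is strictly $k$-polynomially rich if and only if one of the following holds: (1) $m\in\mathbb{N}$, $q\in\{2,3,5\}$, $n=1$, and $k=1$; (2) $m=1$, $q=2$, $n\in\{2,3\}$, and $k=1$; (3) $m=1$, $q=3$, $n=2$, and $k=1$; (4) $m=1$, $q=2$, $n=1$, and $k\in\{2,3\}$; (5) $m=1$, $q=3$, $n=1$, and $k=2$.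
   Context: Here $\mathbb{N}=\{1,2,3,\dots\}$. The ring $\mathbf{M}_n(\mathbf{D})$ acts on $\mathbf{D}^{(n\times m)}$ by left matrix multiplication. The $k$-ary polynomial functions of this module $V=\mathbf{D}^{(n\times m)}$ are the functions $(x_1,\dots,x_k)\mapsto R_1x_1+\dots+R_kx_k+c$ with $R_1,\dots,R_k\in\mathbf{M}_n(\mathbf{D})$ and $c\in V$. A partial function $f\colon T\to V$ with $T\subseteq V^k$ preserves a relation $B\subseteq V^r$ if, whenever $t^{(1)},\dots,t^{(r)}\in T$ satisfy $(t^{(1)}_j,\dots,t^{(r)}_j)\in B$ for every $j\le k$, then $(f(t^{(1)}),\dots,f(t^{(r)}))\in B$. The function $f$ is type-preserving if it preserves every congruence of the module (that is, the relation $\{(x,y)\mid x-y\in S\}$ for each submodule $S$), and for each pair of submodules $S\prec S'$ (i.e. $S\subsetneq S'$ with no submodule strictly in between) it preserves the relation $\rho(S,S')=\{(x_1,x_2,x_3,x_4)\in V^4\mid x_1-x_2\in S',\ x_2-x_3\in S',\ x_1-x_2+x_3-x_4\in S\}$. The module is strictly $k$-polynomially rich if for every $T\subseteq V^k$ and every type-preserving $f\colon T\to V$ there is a $k$-ary polynomial function $p$ of the module with $p|_T=f$. *)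

theory Defs
  imports "HOL-Analysis.Analysis"
begin

text \<open>
  A module is given by its scalar multiplication \<open>smul :: 'r \<Rightarrow> 'v \<Rightarrow> 'v\<close>, with all of \<open>'r\<close> and
  all of \<open>'v\<close> as carriers. The library locale \<open>module\<close> is not applicable, because it
  requires commutative scalars. Only \<open>smul\<close> enters the definitions, not the operations on \<open>'r\<close>:
  on the type \<open>'d^'n^'n\<close> the class operation \<open>*\<close> would be the componentwise product, whereas the
  ring multiplication of square matrices is \<open>**\<close>.
\<close>

definition is_submodule :: "('r \<Rightarrow> 'v \<Rightarrow> 'v) \<Rightarrow> 'v::ab_group_add set \<Rightarrow> bool" where
  "is_submodule smul S \<longleftrightarrow>
     0 \<in> S \<and> (\<forall>x\<in>S. \<forall>y\<in>S. x + y \<in> S) \<and> (\<forall>x\<in>S. - x \<in> S) \<and> (\<forall>r. \<forall>x\<in>S. smul r x \<in> S)"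

definition submodule_covers :: "('r \<Rightarrow> 'v \<Rightarrow> 'v) \<Rightarrow> 'v::ab_group_add set \<Rightarrow> 'v set \<Rightarrow> bool" where
  "submodule_covers smul S S' \<longleftrightarrow>
     is_submodule smul S \<and> is_submodule smul S' \<and> S \<subset> S' \<and>
     \<not> (\<exists>U. is_submodule smul U \<and> S \<subset> U \<and> U \<subset> S')"

text \<open>
  Tuples in \<open>V\<^sup>r\<close> are vectors \<open>'v^'r\<close>. The numeral types \<open>2\<close> and \<open>4\<close> are integers modulo 2 and
  modulo 4, so the index literals \<open>1, 2\<close> and \<open>1, 2, 3, 4\<close> enumerate them without repetition.
\<close>

definition congruence_rel :: "'v::ab_group_add set \<Rightarrow> ('v^2) set" where
  "congruence_rel S = {x. x $ 1 - x $ 2 \<in> S}"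

definition rho :: "'v::ab_group_add set \<Rightarrow> 'v set \<Rightarrow> ('v^4) set" where
  "rho S S' = {x. x $ 1 - x $ 2 \<in> S' \<and> x $ 2 - x $ 3 \<in> S' \<and> x $ 1 - x $ 2 + x $ 3 - x $ 4 \<in> S}"

text \<open>
  A partial function with domain \<open>T\<close> is a total function \<open>f\<close> together with \<open>T\<close>; the values of \<open>f\<close>
  outside \<open>T\<close> are irrelevant in everything below. In \<open>preserves\<close>, the tuple
  \<open>t\<^sup>(\<^sup>i\<^sup>)\<close> is \<open>t $ i\<close>.
\<close>

definition preserves :: "('v^'k) set \<Rightarrow> ('v^'k \<Rightarrow> 'v) \<Rightarrow> ('v^'r) set \<Rightarrow> bool" where
  "preserves T f B \<longleftrightarrow>
     (\<forall>t :: ('v^'k)^'r.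
        (\<forall>i. t $ i \<in> T) \<longrightarrow> (\<forall>j. (\<chi> i. t $ i $ j) \<in> B) \<longrightarrow> (\<chi> i. f (t $ i)) \<in> B)"

definition type_preserving ::
  "('r \<Rightarrow> 'v \<Rightarrow> 'v) \<Rightarrow> ('v::ab_group_add^'k) set \<Rightarrow> ('v^'k \<Rightarrow> 'v) \<Rightarrow> bool" where
  "type_preserving smul T f \<longleftrightarrow>
     (\<forall>S. is_submodule smul S \<longrightarrow> preserves T f (congruence_rel S)) \<and>
     (\<forall>S S'. submodule_covers smul S S' \<longrightarrow> preserves T f (rho S S'))"

definition polynomial_functions ::
  "('r \<Rightarrow> 'v \<Rightarrow> 'v) \<Rightarrow> ('v::ab_group_add^'k \<Rightarrow> 'v) set" where
  "polynomial_functions smul =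
     {p. \<exists>(R :: 'r^'k) c. p = (\<lambda>x. (\<Sum>j\<in>UNIV. smul (R $ j) (x $ j)) + c)}"

text \<open>The arity \<open>k\<close> is \<open>CARD('k)\<close>.\<close>

definition strictly_polynomially_rich ::
  "('r \<Rightarrow> 'v::ab_group_add \<Rightarrow> 'v) \<Rightarrow> 'k::finite itself \<Rightarrow> bool" where
  "strictly_polynomially_rich smul k \<longleftrightarrow>
     (\<forall>(T :: ('v^'k) set) f. type_preserving smul T f \<longrightarrow>
        (\<exists>p \<in> polynomial_functions smul. \<forall>x\<in>T. p x = f x))"

end

theory Submission
  imports Defs
begin

text \<open>
  Write \<open>V = D\<^bsup>n\<times>m\<^esup>\<close>, \<open>q = |D|\<close> and \<open>N = kn\<close>. A point of \<open>V\<^sup>k\<close> is a matrix with \<open>N\<close> rows, indexed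
  by \<open>'k \<times> 'n\<close>, and \<open>m\<close> columns, and a polynomial function is an arbitrary \<open>n \<times> N\<close> matrix acting
  from the left, followed by a translation. Read on \<open>T\<close>, type preservation consists of two kinds
  of conditions: \<open>f w - f x\<close> lies in every submodule that contains the entries of \<open>w - x\<close>, and,
  modulo a submodule \<open>S\<close>, \<open>f\<close> respects additive relations \<open>w - x + y - z = 0\<close> between points of
  \<open>T\<close> whose differences stay in a cover of \<open>S\<close>.

  Only if. It suffices to find a set \<open>T\<close> with so few additive relations that the indicator of one
  point \<open>t0\<close> (with a nonzero value \<open>v\<close>) respects them all, although every polynomial function that
  vanishes at the other points vanishes at \<open>t0\<close> as well (\<open>not_rich_if_indicator_obstruction\<close>). In
  a single column, which is \<open>D\<^sup>N\<close>, take the origin, the unit vectors and the constant vector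
  \<open>(a, \<dots>, a)\<close> (\<open>not_rich_if_simplex_point\<close>). This works with \<open>a = 1\<close> for \<open>q = 2, N \<ge> 4\<close> and for
  \<open>q = 3, N \<ge> 3\<close>, with \<open>a = 2\<close> for \<open>q = 5, N \<ge> 2\<close>, and for all other \<open>q\<close> with any \<open>a\<close> that does
  not form an arithmetic progression with 0 and 1 in any order, nor coincides with one of them.
  Two columns and two rows give room for a further obstruction when \<open>q\<close> is 2 or 3: the points \<open>0\<close>,
  \<open>1\<close> and a root \<open>\<theta>\<close> of \<open>x\<^sup>2 = x + 1\<close>, realized as \<open>2 \<times> 2\<close> matrices. They span a field, hence each
  nonzero combination of them is invertible and generates all values supported in the two columns,
  so that submodules impose no condition beyond additivity, while for a polynomial function the
  values at \<open>0\<close> and \<open>1\<close> determine the value at \<open>\<theta>\<close> (\<open>not_rich_if_two_columns\<close>).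

  If. With one row and \<open>k = 1\<close> the submodules are the subspaces of \<open>D\<^sup>m\<close>. The congruences give
  \<open>f x - f y = s (x - y)\<close> for some scalar \<open>s\<close> depending on \<open>x\<close> and \<open>y\<close>. The scalar is the same
  along the sides of a proper triangle, and on a line because in the fields of order 2, 3 and 5
  any three distinct points of a line form an arithmetic progression, in some order
  (\<open>rich_if_one_row\<close>). With one column, \<open>V\<close> is simple and \<open>f\<close> is subject to
  \<open>f w - f x + f y - f z = 0\<close> whenever \<open>w - x + y - z = 0\<close>. After a translation that brings \<open>0\<close>
  into \<open>T\<close>, choose a basis \<open>B \<subseteq> T\<close> of the span of \<open>T\<close>. For the small parameters in question each
  point of this span is an alternating sum of just three elements of \<open>B \<union> {0}\<close>, so \<open>f\<close> agrees on
  \<open>T\<close> with the linear map that extends its values on \<open>B\<close> (\<open>partially_affine_imp_affine\<close>).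
\<close>

section \<open>Type preservation as additive conditions\<close>

lemma is_submodule_diff:
  "is_submodule smul S \<Longrightarrow> x \<in> S \<Longrightarrow> y \<in> S \<Longrightarrow> x - y \<in> S"
  unfolding is_submodule_def by (metis add_uminus_conv_diff)

lemma is_submodule_sum:
  assumes "is_submodule smul S" "\<And>j. j \<in> A \<Longrightarrow> g j \<in> S"
  shows "sum g A \<in> S"
  using assms by (induction A rule: infinite_finite_induct) (auto simp: is_submodule_def)

text \<open>
  The tuples of tuples in the definition of preservation are unpacked here and in the next lemma,
  so that the conditions can be applied to individual points of \<open>T\<close>.
\<close>

lemma preserves_congruence_rel:
  "preserves T f (congruence_rel S) \<longleftrightarrow>
     (\<forall>x\<in>T. \<forall>y\<in>T. (\<forall>j. x $ j - y $ j \<in> S) \<longrightarrow> f x - f y \<in> S)" (is "?L \<longleftrightarrow> ?R")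
proof
  assume L: ?L
  show ?R
  proof (intro ballI impI)
    fix x y assume *: "x \<in> T" "y \<in> T" "\<forall>j. x $ j - y $ j \<in> S"
    show "f x - f y \<in> S"
      using L[unfolded preserves_def, rule_format, of "\<chi> i. if i = 1 then x else y"] *
      by (simp add: congruence_rel_def)
  qed
next
  assume ?R
  then show ?L by (auto simp: preserves_def congruence_rel_def)
qed

lemma preserves_rho:
  "preserves T f (rho S S') \<longleftrightarrow>
     (\<forall>w\<in>T. \<forall>x\<in>T. \<forall>y\<in>T. \<forall>z\<in>T.
        (\<forall>j. w $ j - x $ j \<in> S' \<and> x $ j - y $ j \<in> S' \<and> w $ j - x $ j + y $ j - z $ j \<in> S) \<longrightarrow>
        f w - f x \<in> S' \<and> f x - f y \<in> S' \<and> f w - f x + f y - f z \<in> S)" (is "?L \<longleftrightarrow> ?R")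
proof
  assume L: ?L
  show ?R
  proof (intro ballI impI)
    fix w x y z
    assume *: "w \<in> T" "x \<in> T" "y \<in> T" "z \<in> T"
      "\<forall>j. w $ j - x $ j \<in> S' \<and> x $ j - y $ j \<in> S' \<and> w $ j - x $ j + y $ j - z $ j \<in> S"
    show "f w - f x \<in> S' \<and> f x - f y \<in> S' \<and> f w - f x + f y - f z \<in> S"
      using L[unfolded preserves_def, rule_format,
          of "\<chi> i. if i = 1 then w else if i = 2 then x else if i = 3 then y else z"] *
      by (simp add: rho_def)
  qed
next
  assume ?R
  then show ?L unfolding preserves_def rho_def mem_Collect_eq vec_lambda_beta by blast
qed

section \<open>Finite fields of order 2, 3 and 5\<close>

text \<open>
  Translation by 1 permutes the ring, so it does not change the sum of all elements; yet it adds 1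
  to each of the summands.
\<close>

lemma of_nat_card_UNIV:
  "of_nat CARD('d) = (0 :: 'd::{ring_1,finite})"
proof -
  have "(\<Sum>x\<in>UNIV. x) = (\<Sum>x\<in>UNIV. x + (1::'d))"
    by (rule sum.reindex_bij_witness[of _ "\<lambda>x. x + 1" "\<lambda>x. x - 1"]) auto
  then show ?thesis by (simp add: sum.distrib)
qed

lemma two_neq_one: "(2::'d::field) \<noteq> 1"
  by (metis add_cancel_right_right one_add_one zero_neq_one)

lemma UNIV_field_2:
  assumes "CARD('d::{field,finite}) = 2"
  shows "(UNIV :: 'd set) = {0, 1}" "(2::'d) = 0"
proof -
  show "(2::'d) = 0" using of_nat_card_UNIV[where 'd = 'd] assms by simp
  have "card {0, 1::'d} = CARD('d)" using assms by simp
  then show "(UNIV :: 'd set) = {0, 1}" by (metis card_subset_eq finite subset_UNIV)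
qed

lemma UNIV_field_3:
  assumes "CARD('d::{field,finite}) = 3"
  shows "(UNIV :: 'd set) = {0, 1, -1}" "(3::'d) = 0" "(2::'d) = -1"
proof -
  show three: "(3::'d) = 0" using of_nat_card_UNIV[where 'd = 'd] assms by simp
  then show two: "(2::'d) = -1" by (simp add: eq_neg_iff_add_eq_0)
  have "(1::'d) \<noteq> -1"
  proof
    assume "(1::'d) = -1"
    then have "(2::'d) = 1" using two by simp
    then show False using two_neq_one[where 'd = 'd] by simp
  qed
  then have "card {0, 1, -1::'d} = CARD('d)" using assms by simp
  then show "(UNIV :: 'd set) = {0, 1, -1}" by (metis card_subset_eq finite subset_UNIV)
qed

lemma UNIV_field_5:
  assumes "CARD('d::{field,finite}) = 5"
  shows "(UNIV :: 'd set) = {0, 1, 2, 3, -1}" "(5::'d) = 0" "distinct [0, 1, 2, 3, -1::'d]"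
proof -
  show five: "(5::'d) = 0" using of_nat_card_UNIV[where 'd = 'd] assms by simp
  have two: "(2::'d) \<noteq> 0"
  proof
    assume "(2::'d) = 0"
    moreover have "(5::'d) = 2 * 2 + 1" by simp
    ultimately show False using five by simp
  qed
  have three: "(3::'d) \<noteq> 0"
  proof
    assume "(3::'d) = 0"
    moreover have "(5::'d) = 3 + 2" by simp
    ultimately show False using five two by simp
  qed
  have four: "(4::'d) \<noteq> 0"
  proof
    assume "(4::'d) = 0"
    moreover have "(5::'d) = 4 + 1" by simp
    ultimately show False using five by simp
  qed
  have "(1::'d) \<noteq> 2" "(1::'d) \<noteq> 3" "(2::'d) \<noteq> 3"
    using two right_minus_eq[of 2 "1::'d"] right_minus_eq[of 3 "1::'d"] right_minus_eq[of 3 "2::'d"] by auto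
  moreover have "(1::'d) \<noteq> -1" "(2::'d) \<noteq> -1" "(3::'d) \<noteq> -1"
    unfolding eq_neg_iff_add_eq_0 using two three four by simp_all
  ultimately show "distinct [0, 1, 2, 3, -1::'d]"
    using two three by simp
  then have "card {0, 1, 2, 3, -1::'d} = CARD('d)" using assms by simp
  then show "(UNIV :: 'd set) = {0, 1, 2, 3, -1}" by (metis card_subset_eq finite subset_UNIV)
qed

text \<open>
  The five exceptional values are exactly those for which 0, 1 and \<open>s\<close> are not distinct or form an
  arithmetic progression in some order.
\<close>

lemma progression_closing_element:
  fixes s :: "'d::{field,finite}"
  assumes "CARD('d) \<in> {2, 3, 5}"
  shows "s \<in> {0, 1, 2, -1} \<or> 2 * s = 1"
proof -
  consider "CARD('d) = 2" | "CARD('d) = 3" | "CARD('d) = 5" using assms by blast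
  then show ?thesis
  proof cases
    case 1
    then show ?thesis using UNIV_field_2(1)[OF 1] by auto
  next
    case 2
    then show ?thesis using UNIV_field_3(1)[OF 2] by auto
  next
    case 3
    have "(6::'d) = 5 + 1" by simp
    then have "2 * 3 = (1::'d)" using UNIV_field_5(2)[OF 3] by simp
    moreover have "s \<in> {0, 1, 2, 3, -1}" using UNIV_field_5(1)[OF 3] by blast
    ultimately show ?thesis by blast
  qed
qed

text \<open>
  The converse of the preceding lemma: at most five elements are excluded, so only order 4 needs
  an argument. There the characteristic is 2, and the excluded elements are just 0 and 1.
\<close>

lemma ex_sidon_element:
  assumes "CARD('d::{field,finite}) \<notin> {2, 3, 5}"
  shows "\<exists>a::'d. a \<notin> {0, 1, 2, -1} \<and> 2 * a \<noteq> 1"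
proof (rule ccontr)
  assume "\<nexists>a::'d. a \<notin> {0, 1, 2, -1} \<and> 2 * a \<noteq> 1"
  then have *: "a \<in> {0, 1, 2, -1} \<or> 2 * a = 1" for a :: 'd by blast
  show False
  proof (cases "(2::'d) = 0")
    case True
    then have "(-1::'d) = 1" by (simp add: neg_eq_iff_add_eq_0)
    then have "a = 0 \<or> a = 1" for a :: 'd using *[of a] True by auto
    then have "(UNIV :: 'd set) = {0, 1}" by blast
    then have "CARD('d) = 2" by (metis card_2_iff zero_neq_one)
    then show False using assms by simp
  next
    case False
    then have "a \<in> {0, 1, 2, -1, 1/2}" for a :: 'd using *[of a] by (auto simp: field_simps)
    then have univ: "(UNIV :: 'd set) = {0, 1, 2, -1, 1/2}" by blast
    have "CARD('d) \<le> 5" unfolding univ by (simp add: card_insert_if)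
    moreover have "CARD('d) \<noteq> 4"
    proof
      assume "CARD('d) = 4"
      then have "(4::'d) = 0" using of_nat_card_UNIV[where 'd = 'd] by simp
      moreover have "(4::'d) = 2 * 2" by simp
      ultimately have "2 * 2 = (0::'d)" by metis
      then show False using False unfolding mult_eq_0_iff by blast
    qed
    moreover have "CARD('d) \<ge> 2"
      using card_mono[of "UNIV :: 'd set" "{0, 1}"] by simp
    ultimately show False using assms by auto
  qed
qed

text \<open>
  The determinant of \<open>a + b\<theta>\<close> where \<open>\<theta>\<^sup>2 = \<theta> + 1\<close>. The polynomial \<open>x\<^sup>2 - x - 1\<close> is irreducible
  over the fields of order 2 and 3, so the form is the norm of a quadratic field extension.
\<close>

lemma norm_form_anisotropic:
  fixes a b :: "'d::{field,finite}"
  assumes "CARD('d) \<in> {2, 3}" "a * (a + b) - b * b = 0"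
  shows "a = 0 \<and> b = 0"
proof -
  consider "CARD('d) = 2" | "CARD('d) = 3" using assms by blast
  then show ?thesis
  proof cases
    case 1
    have "a = 0 \<or> a = 1" "b = 0 \<or> b = 1" using UNIV_field_2(1)[OF 1] by auto
    then show ?thesis using assms(2) UNIV_field_2(2)[OF 1] by auto
  next
    case 2
    have "a = 0 \<or> a = 1 \<or> a = -1" "b = 0 \<or> b = 1 \<or> b = -1" using UNIV_field_3(1)[OF 2] by auto
    then show ?thesis using assms(2) UNIV_field_3(3)[OF 2] two_neq_one[where 'd = 'd] by auto
  qed
qed

section \<open>Obstructions to richness\<close>

text \<open>
  The indicator of \<open>t0\<close> with value \<open>v\<close> preserves types for the following reason. Suppose that an
  alternating sum \<open>w - x + y - z\<close> of points has its entries in a submodule \<open>S\<close>. Either it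
  vanishes, and the indicator respects it by \<open>trivial\<close>, or it generates \<open>v\<close> by \<open>proper\<close>, and then
  \<open>S\<close> contains all values of the indicator. Degenerate sums \<open>w - x + x - x\<close> cover the congruences.
  By \<open>hull\<close> no polynomial function restricts to the indicator.
\<close>

lemma not_rich_if_indicator_obstruction:
  fixes smul :: "'r \<Rightarrow> 'v::ab_group_add \<Rightarrow> 'v" and t0 :: "'v^'k::finite"
  defines "\<delta> v x \<equiv> if x = t0 then v else 0"
  assumes "t0 \<in> T" "v \<noteq> 0"
    and trivial: "\<And>w x y z. {w, x, y, z} \<subseteq> T \<Longrightarrow> w - x + y - z = 0 \<Longrightarrow> \<delta> v w - \<delta> v x + \<delta> v y - \<delta> v z = 0"
    and proper: "\<And>w x y z. {w, x, y, z} \<subseteq> T \<Longrightarrow> w - x + y - z \<noteq> 0 \<Longrightarrow>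
      \<exists>R::'r^'k. (\<Sum>j\<in>UNIV. smul (R $ j) ((w - x + y - z) $ j)) = v"
    and hull: "\<And>p. p \<in> polynomial_functions smul \<Longrightarrow> \<forall>x\<in>T - {t0}. p x = 0 \<Longrightarrow> p t0 = 0"
  shows "\<not> strictly_polynomially_rich smul TYPE('k)"
proof
  assume rich: "strictly_polynomially_rich smul TYPE('k)"
  have key: "\<delta> v w - \<delta> v x + \<delta> v y - \<delta> v z \<in> S"
    if S: "is_submodule smul S" and T: "{w, x, y, z} \<subseteq> T"
      and d: "\<And>j. w $ j - x $ j + y $ j - z $ j \<in> S" for S w x y z
  proof (cases "w - x + y - z = 0")
    case True
    then show ?thesis using trivial[OF T] S by (simp add: is_submodule_def)
  next
    case False
    then obtain R :: "'r^'k" where "(\<Sum>j\<in>UNIV. smul (R $ j) ((w - x + y - z) $ j)) = v"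
      using proper[OF T] by blast
    moreover have "(\<Sum>j\<in>UNIV. smul (R $ j) ((w - x + y - z) $ j)) \<in> S"
      using S d by (intro is_submodule_sum[OF S]) (auto simp: is_submodule_def)
    ultimately have "v \<in> S" by simp
    then have "\<delta> v u \<in> S" for u using S by (simp add: \<delta>_def is_submodule_def)
    moreover have "a + b \<in> S" if "a \<in> S" "b \<in> S" for a b
      using S that by (simp add: is_submodule_def)
    ultimately show ?thesis using is_submodule_diff[OF S] by metis
  qed
  have cong: "\<delta> v w - \<delta> v x \<in> S"
    if "is_submodule smul S" "w \<in> T" "x \<in> T" "\<And>j. w $ j - x $ j \<in> S" for S w x
    using key[of S w x x x] that by simp
  have "type_preserving smul T (\<delta> v)"
    unfolding type_preserving_def preserves_congruence_rel preserves_rho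
    using cong key by (auto simp: submodule_covers_def)
  then obtain p where p: "p \<in> polynomial_functions smul" "\<forall>x\<in>T. p x = \<delta> v x"
    using rich unfolding strictly_polynomially_rich_def by blast
  then have "p t0 = 0" by (intro hull) (auto simp: \<delta>_def)
  then show False using p \<open>t0 \<in> T\<close> \<open>v \<noteq> 0\<close> by (simp add: \<delta>_def)
qed

text \<open>
  This makes a polynomial function on \<open>V\<^sup>k\<close> visible as one matrix whose columns are indexed by
  \<open>'k \<times> 'n\<close>.
\<close>

lemma linear_part_entry:
  fixes R :: "'d::comm_ring_1^'n::finite^'n^'k::finite" and x :: "'d^'m::finite^'n^'k"
  shows "(\<Sum>j\<in>UNIV. R $ j ** x $ j) $ i $ c = (\<Sum>q\<in>UNIV. R $ fst q $ i $ snd q * x $ fst q $ snd q $ c)"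
  by (simp add: matrix_matrix_mult_def sum.cartesian_product case_prod_beta)

lemma row_combination_is_linear_part:
  fixes u :: "'k::finite \<times> 'n::finite \<Rightarrow> 'd::comm_ring_1" and x :: "'d^'m::finite^'n^'k" and v :: "'d^'m^'n"
  assumes "\<And>c. (\<Sum>q\<in>UNIV. u q * x $ fst q $ snd q $ c) = v $ r $ c" "\<And>i c. i \<noteq> r \<Longrightarrow> v $ i $ c = 0"
  shows "\<exists>R::'d^'n^'n^'k. (\<Sum>j\<in>UNIV. R $ j ** x $ j) = v"
proof
  show "(\<Sum>j\<in>UNIV. (\<chi> j i l. if i = r then u (j, l) else 0) $ j ** x $ j) = v"
    unfolding vec_eq_iff linear_part_entry
  proof (intro allI)
    fix i c
    show "(\<Sum>q\<in>UNIV. (\<chi> j i l. if i = r then u (j, l) else 0) $ fst q $ i $ snd q * x $ fst q $ snd q $ c) = v $ i $ c"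
      using assms by (cases "i = r") simp_all
  qed
qed

text \<open>
  The embedding of \<open>D\<^sup>N\<close> as one column of the matrices with \<open>N\<close> rows.
\<close>

definition column_point :: "'m \<Rightarrow> ('k \<times> 'n \<Rightarrow> 'd) \<Rightarrow> 'd::zero^'m::finite^'n::finite^'k::finite" where
  "column_point c h = (\<chi> j i c'. if c' = c then h (j, i) else 0)"

text \<open>
  The vertices of the standard simplex: the origin for \<open>None\<close>, and the unit vectors.
\<close>

fun vertex :: "'i option \<Rightarrow> 'i \<Rightarrow> 'd::zero_neq_one" where
  "vertex None = (\<lambda>_. 0)"
| "vertex (Some s) = (\<lambda>i. if i = s then 1 else 0)"

lemma column_point_combine:
  fixes g h :: "'k::finite \<times> 'n::finite \<Rightarrow> 'd::ring_1"
  shows "column_point c g - column_point c h = (column_point c (\<lambda>i. g i - h i) :: 'd^'m::finite^'n^'k)"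
    "column_point c g + column_point c h = (column_point c (\<lambda>i. g i + h i) :: 'd^'m^'n^'k)"
  by (auto simp: column_point_def vec_eq_iff)

lemma column_point_inject:
  "column_point c g = column_point c h \<longleftrightarrow> g = h"
  by (auto simp: column_point_def vec_eq_iff fun_eq_iff)

text \<open>
  The two assumptions say that the constant vector \<open>a\<close> is not involved in nontrivial relations
  \<open>w + y = x + z\<close> with vertices of the simplex, where it may occur once or twice on one side. A
  double occurrence is harmless in characteristic 2, because the values of the indicator then
  cancel as well. As the vertices affinely span the column, a polynomial function that vanishes on
  them vanishes on all of it.
\<close>

lemma not_rich_if_simplex_point:
  fixes a :: "'d::{field,finite}"
  assumes single: "\<And>o1 o2 o3 :: ('k::finite \<times> 'n::finite) option. \<exists>i. a + vertex o1 i \<noteq> vertex o2 i + vertex o3 i"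
    and double: "2 = (0::'d) \<or> (\<forall>o1 o2 :: ('k \<times> 'n) option. \<exists>i. 2 * a \<noteq> vertex o1 i + vertex o2 i)"
  shows "\<not> strictly_polynomially_rich
            ((**) :: 'd^'n^'n \<Rightarrow> 'd^'m::finite^'n \<Rightarrow> 'd^'m^'n) TYPE('k)"
proof -
  obtain c0 :: 'm and r0 :: 'n where True by blast
  define P :: "('k \<times> 'n \<Rightarrow> 'd) set" where "P = range vertex"
  define v :: "'d^'m^'n" where "v = (\<chi> i c. if i = r0 \<and> c = c0 then 1 else 0)"
  define t where "t = (\<lambda>_ :: 'k \<times> 'n. a)"
  have one_t: False if P: "x \<in> P" "y \<in> P" "z \<in> P" and eq: "\<And>i. t i + x i = y i + z i" for x y z
  proof -
    obtain o1 o2 o3 where "x = vertex o1" "y = vertex o2" "z = vertex o3" using P unfolding P_def by blast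
    moreover obtain i where "a + vertex o1 i \<noteq> vertex o2 i + vertex o3 i" using single by blast
    ultimately show False using eq[of i] by (simp add: t_def)
  qed
  have t_not_vertex: "t \<notin> P"
    using one_t[of t t t] by blast
  have two_t: "2 = (0::'d)" if P: "y \<in> P" "z \<in> P" and eq: "\<And>i. t i + t i = y i + z i" for y z
  proof -
    obtain o2 o3 where "y = vertex o2" "z = vertex o3" using P unfolding P_def by blast
    then show ?thesis using double eq unfolding t_def mult_2[symmetric] by (metis (no_types))
  qed
  have indicator: "(if w = t then e else 0) - (if x = t then e else 0) +
      (if y = t then e else 0) - (if z = t then e else 0) = (0::'d)"
    if *: "w \<in> insert t P" "x \<in> insert t P" "y \<in> insert t P" "z \<in> insert t P"
      and eq: "\<And>i. w i - x i + y i - z i = 0" for w x y z e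
  proof -
    have eqs: "w i + y i = x i + z i" "y i + w i = x i + z i" "x i + z i = w i + y i" "z i + x i = w i + y i" for i
      using eq[of i] by (simp_all add: algebra_simps)
    have "y = t \<or> x = t \<or> z = t" if "w = t"
    proof (rule ccontr)
      assume "\<not> (y = t \<or> x = t \<or> z = t)"
      then have "y \<in> P" "x \<in> P" "z \<in> P" using * by auto
      then show False by (rule one_t) (use eqs(1) that in metis)
    qed
    moreover have "w = t \<or> x = t \<or> z = t" if "y = t"
    proof (rule ccontr)
      assume "\<not> (w = t \<or> x = t \<or> z = t)"
      then have "w \<in> P" "x \<in> P" "z \<in> P" using * by auto
      then show False by (rule one_t) (use eqs(2) that in metis)
    qed
    moreover have "z = t \<or> w = t \<or> y = t" if "x = t"
    proof (rule ccontr)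
      assume "\<not> (z = t \<or> w = t \<or> y = t)"
      then have "z \<in> P" "w \<in> P" "y \<in> P" using * by auto
      then show False by (rule one_t) (use eqs(3) that in metis)
    qed
    moreover have "x = t \<or> w = t \<or> y = t" if "z = t"
    proof (rule ccontr)
      assume "\<not> (x = t \<or> w = t \<or> y = t)"
      then have "x \<in> P" "w \<in> P" "y \<in> P" using * by auto
      then show False by (rule one_t) (use eqs(4) that in metis)
    qed
    moreover have "x = t \<longleftrightarrow> z = t" if "w = t" "y = t"
      using eqs(1) that by (auto simp: fun_eq_iff)
    moreover have "w = t \<longleftrightarrow> y = t" if "x = t" "z = t"
      using eqs(1) that by (auto simp: fun_eq_iff)
    moreover have "e + e = 0 \<and> - e - e = 0" if "w = t \<and> y = t \<and> x \<noteq> t \<and> z \<noteq> t \<or> x = t \<and> z = t \<and> w \<noteq> t \<and> y \<noteq> t"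
    proof -
      have "2 = (0::'d)"
        using that
      proof
        assume "w = t \<and> y = t \<and> x \<noteq> t \<and> z \<noteq> t"
        then show ?thesis using two_t[of x z] * eqs(1) by blast
      next
        assume "x = t \<and> z = t \<and> w \<noteq> t \<and> y \<noteq> t"
        then show ?thesis using two_t[of w y] * eqs(3) by blast
      qed
      then have "e + e = 0" by (metis mult_2 mult_zero_left)
      then show ?thesis by (metis add.inverse_neutral minus_add_distrib uminus_add_conv_diff)
    qed
    \<comment> \<open>Either \<open>t\<close> occurs equally often on both sides, or it occurs twice on one side only and \<open>e + e = 0\<close>.\<close>
    ultimately show ?thesis
      by (cases "w = t"; cases "x = t"; cases "y = t"; cases "z = t") simp_all
  qed
  let ?T = "column_point c0 ` insert t P :: ('d^'m^'n^'k) set"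
  show ?thesis
  proof (rule not_rich_if_indicator_obstruction[where T = ?T and v = v])
    show "column_point c0 t \<in> ?T" by blast
    show "v \<noteq> 0" by (auto simp: v_def vec_eq_iff)
  next
    fix w x y z assume T: "{w, x, y, z} \<subseteq> ?T" and eq: "w - x + y - z = 0"
    from T have "w \<in> ?T" "x \<in> ?T" "y \<in> ?T" "z \<in> ?T" by simp_all
    then obtain w' x' y' z' where T': "w' \<in> insert t P" "x' \<in> insert t P" "y' \<in> insert t P" "z' \<in> insert t P"
      and pts: "w = column_point c0 w'" "x = column_point c0 x'" "y = column_point c0 y'" "z = column_point c0 z'"
      by (elim imageE)
    have "(0 :: 'd^'m^'n^'k) = column_point c0 (\<lambda>_. 0)" by (simp add: column_point_def vec_eq_iff)
    with eq have "column_point c0 (\<lambda>i. w' i - x' i + y' i - z' i) = (column_point c0 (\<lambda>_. 0) :: 'd^'m^'n^'k)"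
      unfolding pts column_point_combine by (rule trans)
    then have rel: "w' i - x' i + y' i - z' i = 0" for i
      unfolding column_point_inject by metis
    show "(if w = column_point c0 t then v else 0) - (if x = column_point c0 t then v else 0)
        + (if y = column_point c0 t then v else 0) - (if z = column_point c0 t then v else 0) = 0"
      unfolding pts column_point_inject
    proof (intro vec_eq_iff[THEN iffD2] allI)
      fix i c
      show "((if w' = t then v else 0) - (if x' = t then v else 0) + (if y' = t then v else 0)
          - (if z' = t then v else 0)) $ i $ c = (0 :: 'd^'m^'n) $ i $ c"
        using indicator[OF T' rel, of "v $ i $ c"] by (auto split: if_splits)
    qed
  next
    fix w x y z assume T: "{w, x, y, z} \<subseteq> ?T" and neq: "w - x + y - z \<noteq> 0"
    from T have "w \<in> ?T" "x \<in> ?T" "y \<in> ?T" "z \<in> ?T" by simp_all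
    then obtain w' x' y' z' where
      pts: "w = column_point c0 w'" "x = column_point c0 x'" "y = column_point c0 y'" "z = column_point c0 z'"
      by (elim imageE)
    obtain g where g: "w - x + y - z = column_point c0 g"
      unfolding pts column_point_combine by blast
    have "\<exists>j l. g (j, l) \<noteq> 0"
    proof (rule ccontr)
      assume "\<nexists>j l. g (j, l) \<noteq> 0"
      then have "column_point c0 g = (0 :: 'd^'m^'n^'k)" by (simp add: column_point_def vec_eq_iff)
      then show False using g neq by simp
    qed
    then obtain j l where nz: "g (j, l) \<noteq> 0" by blast
    show "\<exists>R::'d^'n^'n^'k. (\<Sum>j\<in>UNIV. R $ j ** (w - x + y - z) $ j) = v"
    proof (rule row_combination_is_linear_part[where u = "\<lambda>q. if q = (j, l) then 1 / g (j, l) else 0" and r = r0])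
      fix c
      show "(\<Sum>q\<in>UNIV. (if q = (j, l) then 1 / g (j, l) else 0) * (w - x + y - z) $ fst q $ snd q $ c) = v $ r0 $ c"
        unfolding g using nz
        by (simp add: column_point_def v_def if_distrib[where f = "\<lambda>x. x * _"] cong: if_cong)
    qed (simp add: v_def)
  next
    fix p assume "p \<in> polynomial_functions ((**) :: 'd^'n^'n \<Rightarrow> 'd^'m^'n \<Rightarrow> 'd^'m^'n)"
      and zero: "\<forall>x\<in>?T - {column_point c0 t}. p x = 0"
    then obtain R :: "'d^'n^'n^'k" and b where p: "p = (\<lambda>x. (\<Sum>j\<in>UNIV. R $ j ** x $ j) + b)"
      by (auto simp: polynomial_functions_def)
    have vanish: "p (column_point c0 (vertex v1)) = 0" for v1
    proof -
      have "vertex v1 \<in> P" by (simp add: P_def)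
      moreover from this t_not_vertex have "vertex v1 \<noteq> t" by metis
      ultimately show ?thesis using zero by (simp add: column_point_inject)
    qed
    have "b $ i $ c = 0" for i c
    proof -
      have "p (column_point c0 (vertex None)) $ i $ c = 0" unfolding vanish by simp
      then show ?thesis unfolding p vector_add_component linear_part_entry by (simp add: column_point_def)
    qed
    then have "b = 0" by (simp add: vec_eq_iff)
    have "R $ j $ i $ l = 0" for i j l
    proof -
      have "p (column_point c0 (vertex (Some (j, l)))) $ i $ c0 = 0" unfolding vanish by simp
      moreover have "(column_point c0 (vertex (Some (j, l))) :: 'd^'m^'n^'k) $ fst q $ snd q $ c0 = (if q = (j, l) then 1 else 0)" for q
        by (simp add: column_point_def)
      ultimately show ?thesis
        unfolding p vector_add_component linear_part_entry
        by (simp add: \<open>b = 0\<close> if_distrib[where f = "\<lambda>x. _ * x"] cong: if_cong)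
    qed
    then have "p (column_point c0 t) $ i $ c = 0" for i c
      unfolding p vector_add_component linear_part_entry by (simp add: \<open>b = 0\<close>)
    then show "p (column_point c0 t) = 0" by (simp add: vec_eq_iff)
  qed
qed



lemma sum_two_points:
  fixes f :: "'i::finite \<Rightarrow> 'a::comm_monoid_add"
  assumes "p \<noteq> q" "\<And>r. r \<noteq> p \<Longrightarrow> r \<noteq> q \<Longrightarrow> f r = 0"
  shows "sum f UNIV = f p + f q"
proof -
  have "sum f UNIV = sum f {p, q}"
    using assms by (intro sum.mono_neutral_right) auto
  then show ?thesis using assms(1) by simp
qed

text \<open>
  The matrix of multiplication by \<open>a + b\<theta>\<close>, where \<open>\<theta>\<^sup>2 = \<theta> + 1\<close>, placed in the rows \<open>p1\<close>, \<open>p2\<close> and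
  the columns \<open>c1\<close>, \<open>c2\<close>.
\<close>

definition block :: "'k \<times> 'n \<Rightarrow> 'k \<times> 'n \<Rightarrow> 'm \<Rightarrow> 'm \<Rightarrow> 'd \<Rightarrow> 'd \<Rightarrow> 'd::comm_ring_1^'m::finite^'n::finite^'k::finite" where
  "block p1 p2 c1 c2 a b = (\<chi> j i c.
     if (j, i) = p1 then (if c = c1 then a else if c = c2 then b else 0)
     else if (j, i) = p2 then (if c = c1 then b else if c = c2 then a + b else 0)
     else 0)"

text \<open>
  The obstruction consists of the points \<open>0\<close>, \<open>1\<close> and \<open>\<theta>\<close>. Every nonzero combination \<open>a + b\<theta>\<close> is
  an invertible block and generates \<open>v\<close>; the row of coefficients that does this is read off from
  the inverse. The combination vanishes only if the coefficient of \<open>\<theta>\<close> does, which is the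
  condition for the indicator of \<open>\<theta>\<close>. A matrix that kills the invertible block \<open>1\<close> kills both rows
  of the block, and so it kills \<open>\<theta>\<close>.
\<close>

lemma not_rich_if_two_columns:
  assumes norm: "\<And>a b :: 'd::{field,finite}. a * (a + b) - b * b = 0 \<Longrightarrow> a = 0 \<and> b = 0"
    and rows: "CARD('k::finite \<times> 'n::finite) \<ge> 2" and columns: "CARD('m::finite) \<ge> 2"
  shows "\<not> strictly_polynomially_rich
            ((**) :: 'd^'n^'n \<Rightarrow> 'd^'m^'n \<Rightarrow> 'd^'m^'n) TYPE('k)"
proof -
  obtain p1 p2 :: "'k \<times> 'n" where p: "p1 \<noteq> p2"
    using rows ex_card[of 2 "UNIV :: ('k \<times> 'n) set"] by (auto simp: card_2_iff)
  obtain c1 c2 :: 'm where c: "c1 \<noteq> c2"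
    using columns ex_card[of 2 "UNIV :: 'm set"] by (auto simp: card_2_iff)
  obtain r0 :: 'n where True by blast
  define B :: "'d \<Rightarrow> 'd \<Rightarrow> 'd^'m^'n^'k" where "B = block p1 p2 c1 c2"
  define v :: "'d^'m^'n" where "v = (\<chi> i c. if i = r0 \<and> c = c1 then 1 else 0)"
  have B_row1: "B a b $ fst p1 $ snd p1 $ c = (if c = c1 then a else if c = c2 then b else 0)" for a b c
    by (simp add: B_def block_def)
  have B_row2: "B a b $ fst p2 $ snd p2 $ c = (if c = c1 then b else if c = c2 then a + b else 0)" for a b c
    using p by (auto simp add: B_def block_def)
  have B_other: "B a b $ fst q $ snd q $ c = 0" if "q \<noteq> p1" "q \<noteq> p2" for a b c q
    using that by (simp add: B_def block_def)
  have B_sum: "(\<Sum>q\<in>UNIV. u q * B a b $ fst q $ snd q $ c) =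
      u p1 * (if c = c1 then a else if c = c2 then b else 0)
      + u p2 * (if c = c1 then b else if c = c2 then a + b else 0)" for u a b c
    by (subst sum_two_points[OF p]) (auto simp: B_other B_row1 B_row2)
  have B_combine: "B a b - B a' b' = B (a - a') (b - b')" "B a b + B a' b' = B (a + a') (b + b')" for a b a' b'
    by (auto simp: B_def block_def vec_eq_iff)
  have B_zero: "B a b = 0 \<longleftrightarrow> a = 0 \<and> b = 0" for a b
  proof
    assume "B a b = 0"
    then have "B a b $ fst p1 $ snd p1 $ c1 = 0" "B a b $ fst p1 $ snd p1 $ c2 = 0" by simp_all
    then show "a = 0 \<and> b = 0" using c by (simp add: B_row1)
  qed (auto simp: B_def block_def vec_eq_iff)
  have B_inject: "B a b = B a' b' \<longleftrightarrow> a = a' \<and> b = b'" for a b a' b'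
    using B_zero[of "a - a'" "b - b'"] by (simp flip: B_combine)
  let ?T = "{B 0 0, B 1 0, B 0 1}"
  have rep: "\<exists>a b. w = B a b \<and> (\<forall>i c. (if w = B 0 1 then v else 0) $ i $ c = b * v $ i $ c)" if "w \<in> ?T" for w
    using that by (auto simp: B_inject)
  show ?thesis
  proof (rule not_rich_if_indicator_obstruction[where T = ?T and v = v])
    show "B 0 1 \<in> ?T" by blast
    show "v \<noteq> 0" by (auto simp: v_def vec_eq_iff)
  next
    fix w x y z assume T: "{w, x, y, z} \<subseteq> ?T" and eq: "w - x + y - z = 0"
    then have "w \<in> ?T" "x \<in> ?T" "y \<in> ?T" "z \<in> ?T" by blast+
    from this[THEN rep] obtain aw bw ax bx ay "by" az bz where
      pts: "w = B aw bw" "x = B ax bx" "y = B ay by" "z = B az bz" and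
      ind: "\<And>i c. (if w = B 0 1 then v else 0) $ i $ c = bw * v $ i $ c"
        "\<And>i c. (if x = B 0 1 then v else 0) $ i $ c = bx * v $ i $ c"
        "\<And>i c. (if y = B 0 1 then v else 0) $ i $ c = by * v $ i $ c"
        "\<And>i c. (if z = B 0 1 then v else 0) $ i $ c = bz * v $ i $ c"
      by (elim exE conjE) metis
    have "bw - bx + by - bz = 0"
      using eq unfolding pts B_combine B_zero by blast
    then have "bw * v $ i $ c - bx * v $ i $ c + by * v $ i $ c - bz * v $ i $ c = 0" for i c
      by (metis left_diff_distrib distrib_right mult_zero_left)
    then show "(if w = B 0 1 then v else 0) - (if x = B 0 1 then v else 0)
        + (if y = B 0 1 then v else 0) - (if z = B 0 1 then v else 0) = 0"
      by (intro vec_eq_iff[THEN iffD2] allI)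
        (simp only: vector_add_component vector_minus_component ind zero_index)
  next
    fix w x y z assume T: "{w, x, y, z} \<subseteq> ?T" and neq: "w - x + y - z \<noteq> 0"
    then have "w \<in> ?T" "x \<in> ?T" "y \<in> ?T" "z \<in> ?T" by blast+
    from this[THEN rep] obtain aw bw ax bx ay "by" az bz where
      pts: "w = B aw bw" "x = B ax bx" "y = B ay by" "z = B az bz"
      by (elim exE conjE) metis
    obtain a b where ab: "w - x + y - z = B a b"
      unfolding pts B_combine by blast
    \<comment> \<open>The inverse of the block has the first row \<open>((a + b) / N, - b / N)\<close>.\<close>
    define N where "N = a * (a + b) - b * b"
    have "N \<noteq> 0" using norm[of a b] neq unfolding ab B_zero N_def by blast
    show "\<exists>R::'d^'n^'n^'k. (\<Sum>j\<in>UNIV. R $ j ** (w - x + y - z) $ j) = v"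
    proof (rule row_combination_is_linear_part[where u = "\<lambda>q. if q = p1 then (a + b) / N else - b / N" and r = r0])
      fix c
      show "(\<Sum>q\<in>UNIV. (if q = p1 then (a + b) / N else - b / N) * (w - x + y - z) $ fst q $ snd q $ c) = v $ r0 $ c"
        unfolding ab B_sum using p c \<open>N \<noteq> 0\<close>
        by (auto simp: v_def field_simps) (auto simp: N_def algebra_simps)
    qed (simp add: v_def)
  next
    fix f assume "f \<in> polynomial_functions ((**) :: 'd^'n^'n \<Rightarrow> 'd^'m^'n \<Rightarrow> 'd^'m^'n)"
      and zero: "\<forall>x\<in>?T - {B 0 1}. f x = 0"
    then obtain R :: "'d^'n^'n^'k" and b where f: "f = (\<lambda>x. (\<Sum>j\<in>UNIV. R $ j ** x $ j) + b)"
      by (auto simp: polynomial_functions_def)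
    have f0: "f (B 0 0) = 0" and f1: "f (B 1 0) = 0"
      using zero by (auto simp: B_inject)
    have entry: "f (B s t) $ i $ c =
        R $ fst p1 $ i $ snd p1 * (if c = c1 then s else if c = c2 then t else 0)
      + R $ fst p2 $ i $ snd p2 * (if c = c1 then t else if c = c2 then s + t else 0) + b $ i $ c" for s t i c
      unfolding f vector_add_component linear_part_entry B_sum by simp
    have b: "b $ i $ c = 0" for i c
      using f0 entry[of 0 0 i c] by (simp split: if_splits)
    have "R $ fst p1 $ i $ snd p1 = 0" "R $ fst p2 $ i $ snd p2 = 0" for i
      using f1 entry[of 1 0 i c1] entry[of 1 0 i c2] b c by simp_all
    then show "f (B 0 1) = 0"
      by (simp add: vec_eq_iff entry b)
  qed
qed

text \<open>
  Each vertex is nonzero in at most one coordinate.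
\<close>

lemma ex_avoided_vertex:
  assumes "length vs < CARD('i::finite)"
  shows "\<exists>i::'i. \<forall>v\<in>set vs. vertex v i = (0::'d::zero_neq_one)"
proof -
  have "\<not> Some ` (UNIV :: 'i set) \<subseteq> set vs"
  proof
    assume "Some ` (UNIV :: 'i set) \<subseteq> set vs"
    then have "CARD('i) \<le> card (set vs)"
      by (metis List.finite_set card_image card_mono inj_Some)
    then show False using assms card_length[of vs] by linarith
  qed
  then obtain i :: 'i where i: "Some i \<notin> set vs" by blast
  have "vertex v i = (0::'d)" if "v \<in> set vs" for v
  proof -
    have "v \<noteq> Some i" using that i by metis
    then show ?thesis by (cases v) auto
  qed
  then show ?thesis by blast
qed

lemma vertex_0_or_1: "vertex v i = (0 :: 'a::zero_neq_one) \<or> vertex v i = (1 :: 'a)"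
  by (cases v) auto

text \<open>
  A single coordinate suffices here: vertices have the coordinates 0 and 1 only, and \<open>a\<close> is chosen
  such that none of \<open>a\<close>, \<open>a + 1\<close> is a sum of two of these, nor \<open>2 a\<close> unless it is 0 in
  characteristic 2.
\<close>

lemma not_rich_if_field_order_not_2_3_5:
  assumes "CARD('d::{field,finite}) \<notin> {2, 3, 5}"
  shows "\<not> strictly_polynomially_rich
            ((**) :: 'd^'n::finite^'n \<Rightarrow> 'd^'m::finite^'n \<Rightarrow> 'd^'m^'n) TYPE('k::finite)"
proof -
  obtain a :: 'd where a: "a \<notin> {0, 1, 2, -1}" "2 * a \<noteq> 1"
    using ex_sidon_element[OF assms] by blast
  show ?thesis
  proof (rule not_rich_if_simplex_point[of a])
    fix v1 v2 v3 :: "('k \<times> 'n) option"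
    fix i
    have "a + 1 \<noteq> 0" "a + 1 \<noteq> 2"
      using a eq_neg_iff_add_eq_0[of a 1] add_right_cancel[of a 1 1] by simp_all
    then have "a + vertex v1 i \<noteq> vertex v2 i + vertex v3 i"
      using a vertex_0_or_1[of v1 i, where ?'a = 'd] vertex_0_or_1[of v2 i, where ?'a = 'd] vertex_0_or_1[of v3 i, where ?'a = 'd]
      by (elim disjE) simp_all
    then show "\<exists>i. a + vertex v1 i \<noteq> vertex v2 i + vertex v3 i" by blast
  next
    have "2 * a \<noteq> vertex v1 i + vertex v2 i" if "(2::'d) \<noteq> 0" for v1 v2 :: "('k \<times> 'n) option" and i
      using that a vertex_0_or_1[of v1 i, where ?'a = 'd] vertex_0_or_1[of v2 i, where ?'a = 'd] by (elim disjE) simp_all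
    then show "(2::'d) = 0 \<or> (\<forall>v1 v2 :: ('k \<times> 'n) option. \<exists>i. 2 * a \<noteq> vertex v1 i + vertex v2 i)" by blast
  qed
qed

text \<open>
  In a relation \<open>t + x = y + z\<close> between the constant vector \<open>t\<close> and three vertices, pick a
  coordinate in which enough of the vertices vanish: all three for order 2, \<open>y\<close> and \<open>z\<close> for order
  3, and \<open>y\<close> for order 5. In this coordinate the two sides differ, the left-hand side being 1, one
  of 1 and 2, or one of 2 and 3, respectively. The same choice rules out \<open>t + t = y + z\<close> in orders
  3 and 5, where \<open>t + t\<close> has all coordinates 2 and -1, respectively.
\<close>

lemma not_rich_if_many_rows:
  assumes "CARD('d::{field,finite}) = 2 \<and> CARD('k::finite \<times> 'n::finite) \<ge> 4 \<or>
    CARD('d) = 3 \<and> CARD('k \<times> 'n) \<ge> 3 \<or> CARD('d) = 5 \<and> CARD('k \<times> 'n) \<ge> 2"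
  shows "\<not> strictly_polynomially_rich
            ((**) :: 'd^'n^'n \<Rightarrow> 'd^'m::finite^'n \<Rightarrow> 'd^'m^'n) TYPE('k)"
  using assms
proof (elim disjE conjE)
  assume q: "CARD('d) = 2" and N: "CARD('k \<times> 'n) \<ge> 4"
  show ?thesis
  proof (rule not_rich_if_simplex_point[of 1])
    fix v1 v2 v3 :: "('k \<times> 'n) option"
    obtain i where "\<forall>v\<in>set [v1, v2, v3]. vertex v i = (0::'d)"
      using ex_avoided_vertex[of "[v1, v2, v3]"] N by auto
    then show "\<exists>i. (1::'d) + vertex v1 i \<noteq> vertex v2 i + vertex v3 i"
      by (intro exI[of _ i]) simp
  qed (simp add: UNIV_field_2(2)[OF q])
next
  assume q: "CARD('d) = 3" and N: "CARD('k \<times> 'n) \<ge> 3"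
  have two: "(2::'d) \<noteq> 0"
    using UNIV_field_3(3)[OF q] by (metis neg_equal_0_iff_equal zero_neq_one)
  show ?thesis
  proof (rule not_rich_if_simplex_point[of 1])
    fix v1 v2 v3 :: "('k \<times> 'n) option"
    obtain i where "\<forall>v\<in>set [v2, v3]. vertex v i = (0::'d)"
      using ex_avoided_vertex[of "[v2, v3]"] N by auto
    then have "(1::'d) + vertex v1 i \<noteq> vertex v2 i + vertex v3 i"
      using two vertex_0_or_1[of v1 i, where ?'a = 'd] by (elim disjE) simp_all
    then show "\<exists>i. (1::'d) + vertex v1 i \<noteq> vertex v2 i + vertex v3 i" by blast
  next
    have "\<exists>i. 2 * 1 \<noteq> vertex v1 i + (vertex v2 i :: 'd)" for v1 v2 :: "('k \<times> 'n) option"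
    proof -
      obtain i where "\<forall>v\<in>set [v1, v2]. vertex v i = (0::'d)"
        using ex_avoided_vertex[of "[v1, v2]"] N by auto
      then show ?thesis
        using two by (intro exI[of _ i]) simp
    qed
    then show "(2::'d) = 0 \<or> (\<forall>v1 v2 :: ('k \<times> 'n) option. \<exists>i. 2 * 1 \<noteq> vertex v1 i + (vertex v2 i :: 'd))" by blast
  qed
next
  assume q: "CARD('d) = 5" and N: "CARD('k \<times> 'n) \<ge> 2"
  have neq: "(2::'d) \<noteq> 0" "(2::'d) \<noteq> 1" "(3::'d) \<noteq> 0" "(3::'d) \<noteq> 1"
    and minus_one: "(-1::'d) \<noteq> 0" "(-1::'d) \<noteq> 1"
    using UNIV_field_5(3)[OF q] by auto
  show ?thesis
  proof (rule not_rich_if_simplex_point[of 2])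
    fix v1 v2 v3 :: "('k \<times> 'n) option"
    obtain i where i: "vertex v2 i = (0::'d)"
      using ex_avoided_vertex[of "[v2]"] N by auto
    have "(2::'d) + vertex v1 i \<in> {2, 3}"
      using vertex_0_or_1[of v1 i, where ?'a = 'd] by auto
    moreover have "vertex v2 i + vertex v3 i \<in> {0, 1::'d}"
      using vertex_0_or_1[of v3 i, where ?'a = 'd] i by auto
    ultimately have "(2::'d) + vertex v1 i \<noteq> vertex v2 i + vertex v3 i"
      using neq by (metis empty_iff insertE)
    then show "\<exists>i. (2::'d) + vertex v1 i \<noteq> vertex v2 i + vertex v3 i" by blast
  next
    have "\<exists>i. 2 * 2 \<noteq> vertex v1 i + (vertex v2 i :: 'd)" for v1 v2 :: "('k \<times> 'n) option"
    proof -
      obtain i where i: "vertex v1 i = (0::'d)"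
        using ex_avoided_vertex[of "[v1]"] N by auto
      have "2 * 2 = (-1::'d)"
        using UNIV_field_5(2)[OF q] unfolding eq_neg_iff_add_eq_0 by simp
      moreover have "vertex v1 i + vertex v2 i \<in> {0, 1::'d}"
        using vertex_0_or_1[of v2 i, where ?'a = 'd] i by auto
      ultimately have "2 * 2 \<noteq> vertex v1 i + (vertex v2 i :: 'd)"
        using minus_one by (metis empty_iff insertE)
      then show ?thesis by blast
    qed
    then show "(2::'d) = 0 \<or> (\<forall>v1 v2 :: ('k \<times> 'n) option. \<exists>i. 2 * 2 \<noteq> vertex v1 i + (vertex v2 i :: 'd))" by blast
  qed
qed

section \<open>Modules with one row\<close>

text \<open>
  Fix two points \<open>x0\<close> and \<open>x1\<close> of \<open>T\<close>, with the scalar \<open>l\<close> for their difference. A third point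
  that is not collinear with them has the same scalar with respect to both, since the differences
  are linearly independent. A collinear point \<open>x0 + s (x1 - x0)\<close> completes an arithmetic
  progression with \<open>x0\<close> and \<open>x1\<close>, which is a relation within the line, and the line covers the
  zero submodule.
\<close>

lemma rich_if_one_row:
  assumes q: "CARD('d::{field,finite}) \<in> {2, 3, 5}" and n: "CARD('n::finite) = 1" and k: "CARD('k::finite) = 1"
  shows "strictly_polynomially_rich
           ((**) :: 'd^'n^'n \<Rightarrow> 'd^'m::finite^'n \<Rightarrow> 'd^'m^'n) TYPE('k)"
  unfolding strictly_polynomially_rich_def
proof (intro allI impI)
  fix T :: "('d^'m^'n^'k) set" and f
  assume tp: "type_preserving ((**) :: 'd^'n^'n \<Rightarrow> 'd^'m^'n \<Rightarrow> 'd^'m^'n) T f"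
  obtain i0 :: 'n where "UNIV = {i0}" using n by (auto simp: card_1_singleton_iff)
  then have i0: "i = i0" for i by blast
  obtain j0 :: 'k where j0': "UNIV = {j0}" using k by (auto simp: card_1_singleton_iff)
  then have j0: "j = j0" for j by blast
  define E :: "'d^'m \<Rightarrow> 'd^'m^'n^'k" where "E = (\<lambda>y. \<chi> j i. y)"
  define X where "X = {y. E y \<in> T}"
  define F where "F = (\<lambda>y. f (E y) $ i0)"
  define line :: "'d^'m \<Rightarrow> ('d^'m^'n) set" where "line d = {M. \<exists>s. M $ i0 = s *s d}" for d
  have smul: "(r ** M) $ i0 = r $ i0 $ i0 *s M $ i0" for r :: "'d^'n^'n" and M :: "'d^'m^'n"
    by (simp add: vec_eq_iff matrix_matrix_mult_def \<open>UNIV = {i0}\<close>)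
  have entry0: "M = N \<longleftrightarrow> M $ i0 = N $ i0" for M N :: "'d^'m^'n"
    using i0 by (metis vec_eq_iff)
  have line: "is_submodule (**) (line d)" for d
    unfolding is_submodule_def line_def
  proof (safe)
    show "\<exists>s. (0 :: 'd^'m^'n) $ i0 = s *s d" by (rule exI[of _ 0]) simp
  next
    fix x y :: "'d^'m^'n" and s t assume "x $ i0 = s *s d" "y $ i0 = t *s d"
    then show "\<exists>s. (x + y) $ i0 = s *s d" by (intro exI[of _ "s + t"]) (simp add: vec.scale_left_distrib)
  next
    fix x :: "'d^'m^'n" and s assume "x $ i0 = s *s d"
    then show "\<exists>s. (- x) $ i0 = s *s d" by (intro exI[of _ "- s"]) (simp add: vec.scale_minus_left)
  next
    fix x :: "'d^'m^'n" and s and r :: "'d^'n^'n" assume "x $ i0 = s *s d"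
    then show "\<exists>s. (r ** x) $ i0 = s *s d" by (intro exI[of _ "r $ i0 $ i0 * s"]) (simp add: smul vec.scale_scale)
  qed
  have covers: "submodule_covers (**) {0} (line d)" if "d \<noteq> 0" for d
    unfolding submodule_covers_def
  proof (intro conjI)
    show "is_submodule (**) {0 :: 'd^'m^'n}" by (simp add: is_submodule_def entry0 smul)
    show "{0} \<subset> line d"
    proof
      show "{0} \<subseteq> line d" using line[of d] by (simp add: is_submodule_def)
      have "(\<chi> i. d) \<in> line d" by (auto simp: line_def intro: exI[of _ 1])
      moreover have "(\<chi> i. d) \<noteq> (0 :: 'd^'m^'n)" using that by (simp add: entry0)
      ultimately show "{0} \<noteq> line d" by blast
    qed
    show "\<nexists>U. is_submodule (**) U \<and> {0} \<subset> U \<and> U \<subset> line d"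
    proof
      assume "\<exists>U. is_submodule (**) U \<and> {0} \<subset> U \<and> U \<subset> line d"
      then obtain U where U: "is_submodule (**) U" "{0} \<subset> U" "U \<subset> line d" by blast
      then obtain u where u: "u \<in> U" "u \<noteq> 0" by blast
      then obtain s where s: "u $ i0 = s *s d" using U by (auto simp: line_def)
      then have "s \<noteq> 0" using u by (auto simp: entry0)
      have "M \<in> U" if "M \<in> line d" for M
      proof -
        obtain t where "M $ i0 = t *s d" using \<open>M \<in> line d\<close> by (auto simp: line_def)
        then have "M = mat (t / s) ** u"
          using \<open>s \<noteq> 0\<close> by (simp add: entry0 smul s mat_def vec.scale_scale)
        then show ?thesis using U(1) u(1) by (auto simp: is_submodule_def)
      qed
      then show False using U(3) by blast
    qed
  qed (fact line)
  have diff: "\<exists>s. F x - F y = s *s (x - y)" if "x \<in> X" "y \<in> X" for x y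
  proof -
    have "preserves T f (congruence_rel (line (x - y)))"
      using tp line by (auto simp: type_preserving_def)
    moreover have "E x $ j - E y $ j \<in> line (x - y)" for j
      by (auto simp: E_def line_def intro: exI[of _ 1])
    ultimately have "f (E x) - f (E y) \<in> line (x - y)"
      using that unfolding preserves_congruence_rel X_def by blast
    then show ?thesis by (simp add: line_def F_def)
  qed
  have parallelogram: "F w - F x + F y - F z = 0"
    if "w \<in> X" "x \<in> X" "y \<in> X" "z \<in> X" "d \<noteq> 0" "w - x = a *s d" "x - y = b *s d" "w - x + y - z = 0"
    for w x y z d a b
  proof -
    have "preserves T f (rho {0} (line d))"
      using tp covers[OF \<open>d \<noteq> 0\<close>] by (auto simp: type_preserving_def)
    moreover have "E w $ j - E x $ j \<in> line d \<and> E x $ j - E y $ j \<in> line d \<and> E w $ j - E x $ j + E y $ j - E z $ j \<in> {0}" for j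
      using that(6-8) by (auto simp: E_def line_def entry0)
    ultimately have "f (E w) - f (E x) + f (E y) - f (E z) \<in> {0}"
      using that(1-4) unfolding preserves_rho X_def by blast
    then show ?thesis by (simp add: F_def entry0)
  qed
  have "\<exists>l c. \<forall>y\<in>X. F y = l *s y + c"
  proof (cases "\<exists>x0\<in>X. \<exists>x1\<in>X. x0 \<noteq> x1")
    case False
    show ?thesis
    proof (cases "X = {}")
      case False
      then obtain x0 where "X = {x0}" using \<open>\<not> (\<exists>x0\<in>X. \<exists>x1\<in>X. x0 \<noteq> x1)\<close> by blast
      then show ?thesis by (intro exI[of _ 0] exI[of _ "F x0"]) simp
    qed simp
  next
    case True
    then obtain x0 x1 where X: "x0 \<in> X" "x1 \<in> X" "x0 \<noteq> x1" by blast
    define d where "d = x1 - x0"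
    have d: "d \<noteq> 0" "x1 = x0 + d" using X by (simp_all add: d_def)
    obtain l where l: "F x1 - F x0 = l *s d" using diff[of x1 x0] X by (auto simp: d_def)
    then have F1: "F x1 = F x0 + l *s d" by (simp add: algebra_simps)
    have "F y - F x0 = l *s (y - x0)" if y: "y \<in> X" for y
    proof (cases "\<exists>s. y - x0 = s *s d")
      case True
      then obtain s where s: "y - x0 = s *s d" by blast
      then have y_eq: "y = x0 + s *s d" by (simp add: algebra_simps)
      \<comment> \<open>The last three cases place the middle term of the progression at \<open>x1\<close>, \<open>x0\<close> and \<open>y\<close>.\<close>
      consider "s = 0" | "s = 1" | "s = 2" | "s = -1" | "2 * s = 1"
        using progression_closing_element[OF q, of s] by blast
      then show ?thesis
      proof cases
        case 1
        then show ?thesis using y_eq by simp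
      next
        case 2
        then show ?thesis using y_eq F1 d by simp
      next
        case 3
        then have "y - x1 + x0 - x1 = 0" by (simp add: y_eq d vec_eq_iff algebra_simps)
        moreover have "y - x1 = 1 *s d" "x1 - x0 = 1 *s d" using 3 by (simp_all add: y_eq d vec_eq_iff algebra_simps)
        ultimately have "F y - F x1 + F x0 - F x1 = 0"
          using parallelogram y X d(1) by blast
        then show ?thesis using 3 by (simp add: s F1 vec_eq_iff algebra_simps)
      next
        case 4
        then have "y - x0 + x1 - x0 = 0" by (simp add: y_eq d vec_eq_iff algebra_simps)
        moreover have "y - x0 = -1 *s d" "x0 - x1 = -1 *s d" using 4 by (simp_all add: y_eq d vec_eq_iff algebra_simps)
        ultimately have "F y - F x0 + F x1 - F x0 = 0"
          using parallelogram y X d(1) by blast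
        then show ?thesis using 4 by (simp add: s F1 vec_eq_iff algebra_simps)
      next
        case 5
        have "s *s d + s *s d = d"
          using 5 by (metis mult_2 vec.scale_left_distrib vec.scale_one)
        then have "y - x0 + y - x1 = 0" by (simp add: y_eq d algebra_simps)
        moreover have "y - x0 = s *s d" "x0 - y = (-s) *s d" by (simp_all add: y_eq vec_eq_iff algebra_simps)
        ultimately have "F y - F x0 + F y - F x1 = 0"
          using parallelogram y X d(1) by blast
        then have "2 *s (F y - F x0) = l *s d" by (simp add: F1 vec_eq_iff algebra_simps)
        then have "s *s (2 *s (F y - F x0)) = s *s (l *s d)" by simp
        then show ?thesis using 5 by (simp add: s vec.scale_scale mult.commute)
      qed
    next
      case False
      obtain u where u: "F y - F x0 = u *s (y - x0)" using diff y X by blast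
      obtain v where v: "F y - F x1 = v *s (y - x1)" using diff y X by blast
      have rel: "(l - v) *s d = (u - v) *s (y - x0)"
      proof -
        have "v *s (y - x1) = u *s (y - x0) - l *s d"
          unfolding u[symmetric] v[symmetric] F1 by simp
        then show ?thesis by (simp add: d vec_eq_iff algebra_simps)
      qed
      have "u = v"
      proof (rule ccontr)
        assume "u \<noteq> v"
        then have "1 / (u - v) * (u - v) = 1" by simp
        then have "y - x0 = (1 / (u - v)) *s ((u - v) *s (y - x0))"
          unfolding vec.scale_scale by (simp only: vec.scale_one)
        also have "\<dots> = ((l - v) / (u - v)) *s d" unfolding rel[symmetric] by (simp only: vec.scale_scale) simp
        finally show False using False by blast
      qed
      then have "l = v" using rel d(1) by simp
      then show ?thesis using u \<open>u = v\<close> by simp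
    qed
    then have "\<forall>y\<in>X. F y = l *s y + (F x0 - l *s x0)"
      by (simp add: vec_eq_iff algebra_simps)
    then show ?thesis by blast
  qed
  then obtain l c where lc: "\<And>y. y \<in> X \<Longrightarrow> F y = l *s y + c" by blast
  define p :: "'d^'m^'n^'k \<Rightarrow> 'd^'m^'n" where
    "p = (\<lambda>x. (\<Sum>j\<in>UNIV. (\<chi> j. mat l) $ j ** x $ j) + (\<chi> i. c))"
  have "p \<in> polynomial_functions ((**) :: 'd^'n^'n \<Rightarrow> 'd^'m^'n \<Rightarrow> 'd^'m^'n)"
    unfolding polynomial_functions_def p_def by blast
  moreover have "p x = f x" if "x \<in> T" for x
  proof -
    have x: "x = E (x $ j0 $ i0)"
      using i0 j0 by (simp add: E_def vec_eq_iff) metis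
    then have "x $ j0 $ i0 \<in> X" using that by (simp add: X_def)
    then have "F (x $ j0 $ i0) = l *s x $ j0 $ i0 + c" by (rule lc)
    then have "f x $ i0 = l *s x $ j0 $ i0 + c" unfolding F_def x[symmetric] .
    then show ?thesis by (simp add: entry0 p_def j0' smul mat_def)
  qed
  ultimately show "\<exists>p\<in>polynomial_functions (**). \<forall>x\<in>T. p x = f x" by blast
qed

section \<open>Modules with one column\<close>

text \<open>
  With coefficients 0 and 1 there are at most three summands. For three of them the middle sign is
  immaterial in characteristic 2.
\<close>

lemma span_eq_alternating_sums_2:
  fixes B :: "('d::{field,finite}^'i::finite) set"
  assumes q: "CARD('d) = 2" and B: "finite B" "card B \<le> 3" and y: "y \<in> vec.span B"
  shows "\<exists>a\<in>insert 0 B. \<exists>b\<in>insert 0 B. \<exists>c\<in>insert 0 B. y = a - b + c"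
proof -
  \<comment> \<open>Repetitions and 0 are allowed among the three elements, so smaller sets fit the same pattern.\<close>
  have "\<exists>b1 b2 b3. insert 0 B = {0, b1, b2, b3}"
  proof -
    consider "card B = 0" | "card B = 1" | "card B = 2" | "card B = 3" using B(2) by linarith
    then show ?thesis
    proof cases
      case 1
      then have "B = {}" using B(1) by simp
      then show ?thesis by (metis insert_absorb2)
    next
      case 2
      then obtain b where "B = {b}" by (rule card_1_singletonE)
      then show ?thesis by (metis insert_absorb2)
    next
      case 3
      then obtain b c where "B = {b, c}" unfolding card_2_iff by blast
      then show ?thesis by (metis insert_absorb2)
    next
      case 4
      then show ?thesis unfolding card_3_iff by blast
    qed
  qed
  then obtain b1 b2 b3 where eq: "insert 0 B = {0, b1, b2, b3}" by blast
  have "y \<in> vec.span {0, b1, b2, b3}" using y unfolding eq[symmetric] by (simp add: vec.span_insert_0)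
  then obtain u1 u2 u3 where "y - u1 *s b1 - u2 *s b2 - u3 *s b3 = 0"
    by (auto simp: vec.span_insert_0 vec.span_breakdown_eq)
  then have y_eq: "y = u1 *s b1 + u2 *s b2 + u3 *s b3" by (simp add: algebra_simps)
  have neg: "- b2 = b2"
    using UNIV_field_2(2)[OF q] by (simp add: vec_eq_iff neg_eq_iff_add_eq_0 flip: mult_2)
  have u: "u = 0 \<or> u = 1" for u :: 'd using UNIV_field_2(1)[OF q] by blast
  have three: "b1 + b2 + b3 = b1 - b2 + b3" using neg by (metis diff_conv_add_uminus)
  show ?thesis
    unfolding eq y_eq using u[of u1] u[of u2] u[of u3] three by (elim disjE) auto
qed

text \<open>
  The only combination of \<open>b1\<close> and \<open>b2\<close> with coefficients in \<open>{0, 1, -1}\<close> that does not visibly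
  have the required form is \<open>- b1 - b2\<close>, which is \<open>b1 - b2 + b1\<close> in characteristic 3.
\<close>

lemma span_eq_alternating_sums_3:
  fixes B :: "('d::{field,finite}^'i::finite) set"
  assumes q: "CARD('d) = 3" and B: "finite B" "card B \<le> 2" and y: "y \<in> vec.span B"
  shows "\<exists>a\<in>insert 0 B. \<exists>b\<in>insert 0 B. \<exists>c\<in>insert 0 B. y = a - b + c"
proof -
  have "\<exists>b1 b2. insert 0 B = {0, b1, b2}"
  proof -
    consider "card B = 0" | "card B = 1" | "card B = 2" using B(2) by linarith
    then show ?thesis
    proof cases
      case 1
      then have "B = {}" using B(1) by simp
      then show ?thesis by (metis insert_absorb2)
    next
      case 2
      then obtain b where "B = {b}" by (rule card_1_singletonE)
      then show ?thesis by (metis insert_absorb2)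
    next
      case 3
      then show ?thesis unfolding card_2_iff by blast
    qed
  qed
  then obtain b1 b2 where eq: "insert 0 B = {0, b1, b2}" by blast
  have "y \<in> vec.span {0, b1, b2}" using y unfolding eq[symmetric] by (simp add: vec.span_insert_0)
  then obtain u1 u2 where "y - u1 *s b1 - u2 *s b2 = 0"
    by (auto simp: vec.span_insert_0 vec.span_breakdown_eq)
  then have y_eq: "y = u1 *s b1 + u2 *s b2" by (simp add: algebra_simps)
  have neg: "- b1 = b1 + b1"
    using UNIV_field_3(3)[OF q] by (simp add: vec_eq_iff flip: mult_2)
  have u: "u = 0 \<or> u = 1 \<or> u = -1" for u :: 'd using UNIV_field_3(1)[OF q] by blast
  have "- b1 - b2 = b1 - b2 + b1" using neg by (simp add: algebra_simps)
  then show ?thesis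
    unfolding eq y_eq using u[of u1] u[of u2] by (elim disjE) auto
qed


text \<open>
  A linear map that agrees with \<open>F\<close>, translated to \<open>F 0 = 0\<close>, on a basis contained in the
  translate of \<open>X\<close> agrees with it on all alternating sums of three elements of the basis and 0,
  and these are all of the span.
\<close>

lemma partially_affine_imp_affine:
  fixes X :: "('d::{field,finite}^'i::finite) set" and F :: "'d^'i \<Rightarrow> 'd^'n::finite"
  assumes small: "CARD('d) = 2 \<and> CARD('i) \<le> 3 \<or> CARD('d) = 3 \<and> CARD('i) \<le> 2"
    and parallelogram: "\<And>w x y z. {w, x, y, z} \<subseteq> X \<Longrightarrow> w - x + y - z = 0 \<Longrightarrow> F w - F x + F y - F z = 0"
  shows "\<exists>A c. \<forall>x\<in>X. F x = A *v x + c"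
proof (cases "X = {}")
  case False
  then obtain x0 where x0: "x0 \<in> X" by blast
  define Y where "Y = {y. x0 + y \<in> X}"
  define G where "G y = F (x0 + y) - F x0" for y
  have zero: "0 \<in> Y" "G 0 = 0" using x0 by (simp_all add: Y_def G_def)
  obtain B where B: "B \<subseteq> Y" "vec.independent B" "Y \<subseteq> vec.span B"
    by (rule vec.maximal_independent_subset)
  obtain g where g: "Vector_Spaces.linear (*s) (*s) g" "\<forall>x\<in>B. g x = G x"
    using vec.linear_independent_extend[OF B(2)] by blast
  interpret g: Vector_Spaces.linear "(*s)" "(*s)" g by (fact g(1))
  have "finite B" "card B \<le> vec.dim B"
    using vec.independent_bound_general[OF B(2)] by simp_all
  moreover have "vec.dim B \<le> CARD('i)"
    using vec.dim_subset[OF subset_UNIV, of B] unfolding vec_dim_card .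
  ultimately have B_card: "finite B" "card B \<le> CARD('i)" by simp_all
  have "G y = g y" if y: "y \<in> Y" for y
  proof -
    have span: "y \<in> vec.span B" using y B by blast
    have "\<exists>a\<in>insert 0 B. \<exists>b\<in>insert 0 B. \<exists>c\<in>insert 0 B. y = a - b + c"
      using small
    proof (elim disjE conjE)
      assume "CARD('d) = 2" "CARD('i) \<le> 3"
      with B_card show ?thesis by (intro span_eq_alternating_sums_2[OF _ _ _ span]) simp_all
    next
      assume "CARD('d) = 3" "CARD('i) \<le> 2"
      with B_card show ?thesis by (intro span_eq_alternating_sums_3[OF _ _ _ span]) simp_all
    qed
    then obtain a b c where abc: "a \<in> insert 0 B" "b \<in> insert 0 B" "c \<in> insert 0 B" "y = a - b + c"
      by blast
    then have "{x0 + a, x0 + b, x0 + c, x0 + y} \<subseteq> X" using B(1) zero(1) y by (auto simp: Y_def)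
    moreover have "(x0 + a) - (x0 + b) + (x0 + c) - (x0 + y) = 0" by (simp add: abc(4))
    ultimately have "F (x0 + a) - F (x0 + b) + F (x0 + c) - F (x0 + y) = 0" by (intro parallelogram) simp_all
    then have "G y = G a - G b + G c" by (simp add: G_def algebra_simps)
    moreover have "G u = g u" if "u \<in> insert 0 B" for u using that g(2) zero g.zero by auto
    ultimately show ?thesis using abc by (simp add: g.add g.diff)
  qed
  then have "F x = matrix g *v x + (F x0 - g x0)" if "x \<in> X" for x
    using that \<open>\<And>y. y \<in> Y \<Longrightarrow> G y = g y\<close>[of "x - x0"] 
    by (simp add: matrix_works[OF g(1)] Y_def G_def g.diff algebra_simps)
  then show ?thesis by blast
qed simp

text \<open>
  Over a field a single nonzero column generates all columns, so the zero submodule is covered by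
  the whole module, and \<open>rho {0} UNIV\<close> is the relation \<open>w - x + y - z = 0\<close>.
\<close>

lemma rich_if_one_column:
  assumes m: "CARD('m::finite) = 1"
    and small: "CARD('d::{field,finite}) = 2 \<and> CARD('k::finite \<times> 'n::finite) \<le> 3 \<or> CARD('d) = 3 \<and> CARD('k \<times> 'n) \<le> 2"
  shows "strictly_polynomially_rich
           ((**) :: 'd^'n^'n \<Rightarrow> 'd^'m^'n \<Rightarrow> 'd^'m^'n) TYPE('k)"
  unfolding strictly_polynomially_rich_def
proof (intro allI impI)
  fix T :: "('d^'m^'n^'k) set" and f
  assume tp: "type_preserving ((**) :: 'd^'n^'n \<Rightarrow> 'd^'m^'n \<Rightarrow> 'd^'m^'n) T f"
  obtain c0 :: 'm where "UNIV = {c0}" using m by (auto simp: card_1_singleton_iff)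
  then have c0: "c = c0" for c by blast
  have entry0: "M = N \<longleftrightarrow> (\<forall>i. M $ i $ c0 = N $ i $ c0)" for M N :: "'d^'m^'n"
    by (metis c0 vec_eq_iff)
  have covers: "submodule_covers ((**) :: 'd^'n^'n \<Rightarrow> 'd^'m^'n \<Rightarrow> 'd^'m^'n) {0} UNIV"
    unfolding submodule_covers_def
  proof (intro conjI)
    show "is_submodule (**) {0 :: 'd^'m^'n}" "is_submodule (**) (UNIV :: ('d^'m^'n) set)"
      by (simp_all add: is_submodule_def matrix_matrix_mult_def vec_eq_iff)
    have "(\<chi> i c. 1) \<noteq> (0 :: 'd^'m^'n)" by (simp add: vec_eq_iff)
    then show "{0} \<subset> (UNIV :: ('d^'m^'n) set)" by blast
    show "\<nexists>U :: ('d^'m^'n) set. is_submodule (**) U \<and> {0} \<subset> U \<and> U \<subset> UNIV"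
    proof
      assume "\<exists>U :: ('d^'m^'n) set. is_submodule (**) U \<and> {0} \<subset> U \<and> U \<subset> UNIV"
      then obtain U :: "('d^'m^'n) set" where U: "is_submodule (**) U" "{0} \<subset> U" "U \<subset> UNIV" by blast
      then obtain u where u: "u \<in> U" "u \<noteq> 0" by blast
      then obtain i1 where i1: "u $ i1 $ c0 \<noteq> 0" by (auto simp: entry0)
      have "M \<in> U" for M
      proof -
        have "M = (\<chi> i i'. if i' = i1 then M $ i $ c0 / u $ i1 $ c0 else 0) ** u"
          using i1 by (simp add: entry0 matrix_matrix_mult_def if_distrib[where f = "\<lambda>x. x * _"] cong: if_cong)
        then show ?thesis using U(1) u(1) unfolding is_submodule_def by metis
      qed
      then show False using U(3) by blast
    qed
  qed
  define E :: "'d^('k \<times> 'n) \<Rightarrow> 'd^'m^'n^'k" where "E = (\<lambda>y. \<chi> j i c. y $ (j, i))"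
  define X where "X = {y. E y \<in> T}"
  define F :: "'d^('k \<times> 'n) \<Rightarrow> 'd^'n" where "F = (\<lambda>y. \<chi> i. f (E y) $ i $ c0)"
  have "\<exists>A c. \<forall>x\<in>X. F x = A *v x + c"
  proof (rule partially_affine_imp_affine[OF small])
    fix w x y z assume X: "{w, x, y, z} \<subseteq> X" and rel: "w - x + y - z = 0"
    have "preserves T f (rho {0} UNIV)"
      using tp covers by (auto simp: type_preserving_def)
    moreover have "E w $ j - E x $ j + E y $ j - E z $ j = 0" for j
      using rel by (simp add: E_def vec_eq_iff)
    ultimately have "f (E w) - f (E x) + f (E y) - f (E z) = 0"
      using X unfolding preserves_rho X_def by simp
    then show "F w - F x + F y - F z = 0" by (simp add: F_def vec_eq_iff)
  qed
  then obtain A c where A: "\<And>x. x \<in> X \<Longrightarrow> F x = A *v x + c" by blast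
  define p :: "'d^'m^'n^'k \<Rightarrow> 'd^'m^'n" where
    "p = (\<lambda>x. (\<Sum>j\<in>UNIV. (\<chi> j i l. A $ i $ (j, l)) $ j ** x $ j) + (\<chi> i c'. c $ i))"
  have "p \<in> polynomial_functions ((**) :: 'd^'n^'n \<Rightarrow> 'd^'m^'n \<Rightarrow> 'd^'m^'n)"
    unfolding polynomial_functions_def p_def by blast
  moreover have "p x = f x" if "x \<in> T" for x
    unfolding entry0
  proof
    fix i
    define y where "y = (\<chi> q. x $ fst q $ snd q $ c0)"
    have x: "x = E y"
      by (simp add: E_def y_def vec_eq_iff) (metis c0)
    then have "y \<in> X" using that by (simp add: X_def)
    then have "F y $ i = (A *v y) $ i + c $ i"
      using A by simp
    then have "f x $ i $ c0 = (A *v y) $ i + c $ i"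
      unfolding F_def x[symmetric] by simp
    then show "p x $ i $ c0 = f x $ i $ c0"
      unfolding p_def vector_add_component linear_part_entry
      by (simp add: matrix_vector_mult_def y_def)
  qed
  ultimately show "\<exists>p\<in>polynomial_functions (**). \<forall>x\<in>T. p x = f x" by blast
qed

section \<open>The characterization\<close>

text \<open>
  The obstructions leave \<open>N \<le> 3, 2, 1\<close> for orders 2, 3, 5, and \<open>m = 1\<close> unless \<open>N = 1\<close>.
\<close>

lemma rich_imp_parameters:
  assumes rich: "strictly_polynomially_rich
           ((**) :: 'd::{field,finite}^'n::finite^'n \<Rightarrow> 'd^'m::finite^'n \<Rightarrow> 'd^'m^'n) TYPE('k::finite)"
  shows
      "(CARD('d) \<in> {2, 3, 5} \<and> CARD('n) = 1 \<and> CARD('k) = 1) \<or>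
      (CARD('m) = 1 \<and> CARD('d) = 2 \<and> CARD('n) \<in> {2, 3} \<and> CARD('k) = 1) \<or>
      (CARD('m) = 1 \<and> CARD('d) = 3 \<and> CARD('n) = 2 \<and> CARD('k) = 1) \<or>
      (CARD('m) = 1 \<and> CARD('d) = 2 \<and> CARD('n) = 1 \<and> CARD('k) \<in> {2, 3}) \<or>
      (CARD('m) = 1 \<and> CARD('d) = 3 \<and> CARD('n) = 1 \<and> CARD('k) = 2)"
proof -
  have q: "CARD('d) \<in> {2, 3, 5}"
    using rich not_rich_if_field_order_not_2_3_5 by blast
  have N: "(CARD('d) = 2 \<longrightarrow> CARD('k) * CARD('n) \<le> 3) \<and> (CARD('d) = 3 \<longrightarrow> CARD('k) * CARD('n) \<le> 2)
      \<and> (CARD('d) = 5 \<longrightarrow> CARD('k) * CARD('n) \<le> 1)"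
    using not_rich_if_many_rows[where 'd = 'd and 'k = 'k and 'n = 'n and 'm = 'm] rich by fastforce
  have m: "CARD('m) = 1" if "CARD('k) * CARD('n) \<ge> 2"
  proof (rule ccontr)
    assume "CARD('m) \<noteq> 1"
    moreover have "CARD('m) > 0" by simp
    ultimately have "CARD('m) \<ge> 2" by linarith
    moreover have "CARD('d) \<in> {2, 3}" using q N that by auto
    ultimately show False
      using not_rich_if_two_columns[OF norm_form_anisotropic, where 'd = 'd and 'k = 'k and 'n = 'n and 'm = 'm] that rich
      by simp
  qed
  define k n where "k = CARD('k)" and "n = CARD('n)"
  have pos: "k > 0" "n > 0" by (simp_all add: k_def n_def)
  have le: "k * n \<le> 3" using q N by (auto simp: k_def n_def)
  have "k \<le> k * n" "n \<le> k * n" using pos by simp_all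
  then have "k \<le> 3" "n \<le> 3" using le by linarith+
  then have "k = 1 \<or> k = 2 \<or> k = 3" "n = 1 \<or> n = 2 \<or> n = 3" using pos by auto
  then show ?thesis using q N m unfolding k_def[symmetric] n_def[symmetric] by (elim disjE) simp_all
qed

theorem theorem5p1:
  shows "strictly_polynomially_rich
           ((**) :: 'd::{field,finite}^'n::finite^'n \<Rightarrow> 'd^'m::finite^'n \<Rightarrow> 'd^'m^'n) TYPE('k::finite)
    \<longleftrightarrow>
      (CARD('d) \<in> {2, 3, 5} \<and> CARD('n) = 1 \<and> CARD('k) = 1) \<or>
      (CARD('m) = 1 \<and> CARD('d) = 2 \<and> CARD('n) \<in> {2, 3} \<and> CARD('k) = 1) \<or>
      (CARD('m) = 1 \<and> CARD('d) = 3 \<and> CARD('n) = 2 \<and> CARD('k) = 1) \<or>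
      (CARD('m) = 1 \<and> CARD('d) = 2 \<and> CARD('n) = 1 \<and> CARD('k) \<in> {2, 3}) \<or>
      (CARD('m) = 1 \<and> CARD('d) = 3 \<and> CARD('n) = 1 \<and> CARD('k) = 2)" (is "?rich \<longleftrightarrow> ?scalar \<or> ?simple")
proof
  assume ?rich
  then show "?scalar \<or> ?simple" by (rule rich_imp_parameters)
next
  assume "?scalar \<or> ?simple"
  then show ?rich
  proof
    assume ?scalar
    then show ?rich using rich_if_one_row by blast
  next
    assume ?simple
    then have "CARD('m) = 1"
      "CARD('d) = 2 \<and> CARD('k \<times> 'n) \<le> 3 \<or> CARD('d) = 3 \<and> CARD('k \<times> 'n) \<le> 2" by auto
    then show ?rich by (rule rich_if_one_column)
  qed
qed

end
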